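(* Let $n \geq 2$ be an integer. The complete graph $K_n$ of order $n$ is competitively orientable if and only if $n \geq 7$.
   Context: All graphs are finite and simple. An orientation of a graph $G$ is a digraph $D$ on the vertex set $V(G)$ with no loops, no multiple arcs and no directed $2$-cycles, whose underlying graph (with edge set $\{uv \mid (u,v)\in A(D)\}$) is $G$. A digraph $D$ is competitive if every pair of distinct vertices $x,y$ has a common out-neighbor, i.e. there is a vertex $z$ with $(x,z),(y,z)\in A(D)$. A graph is competitively orientable if it has a competitive orientation. *)

theory Defs
  imports "Graph_Theory.Graph_Theory"
begin

text \<open>
  As in the Graph Theory library, a finite simple graph is a symmetric digraph (locale
  \<^locale>\<open>graph\<close>): the edge \<open>uv\<close> is represented by the two arcs \<open>(u,v)\<close> and \<open>(v,u)\<close>, and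
  \<^const>\<open>mk_symmetric\<close> is the underlying graph of a digraph.  An orientation has no multiple
  arcs, so its arcs are ordered pairs; \<^locale>\<open>pair_digraph\<close> adds finiteness and the absence
  of loops.
\<close>

definition orientation_of :: "'a pair_pre_digraph \<Rightarrow> ('a, 'b) pre_digraph \<Rightarrow> bool" where
  "orientation_of D G \<longleftrightarrow>
     pair_digraph D \<and>
     (\<forall>u v. (u, v) \<in> parcs D \<longrightarrow> (v, u) \<notin> parcs D) \<and>
     pverts D = verts G \<and>
     parcs (mk_symmetric (with_proj D)) = arcs_ends G"

definition competitive :: "('a, 'b) pre_digraph \<Rightarrow> bool" where
  "competitive D \<longleftrightarrow>
     (\<forall>x\<in>verts D. \<forall>y\<in>verts D. x \<noteq> y \<longrightarrow>
        (\<exists>z\<in>verts D. x \<rightarrow>\<^bsub>D\<^esub> z \<and> y \<rightarrow>\<^bsub>D\<^esub> z))"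

definition competitively_orientable :: "('a, 'b) pre_digraph \<Rightarrow> bool" where
  "competitively_orientable G \<longleftrightarrow>
     (\<exists>D. orientation_of D G \<and> competitive (with_proj D))"

end

theory Submission
  imports Defs
begin

text \<open>
  In a competitive orientation, the out-neighbourhood of a vertex \<open>x\<close> has no sink: the common
  out-neighbour of \<open>x\<close> and of \<open>y \<in> N\<^sup>+(x)\<close> lies in \<open>N\<^sup>+(x)\<close> and is dominated by \<open>y\<close>.  So every
  out-degree is at least 3, and counting the arcs of a tournament gives \<open>3 n \<le> n (n - 1) / 2\<close>.
  Conversely, the Paley tournament on 7 vertices is competitive, and this is preserved when a vertex
  dominating all earlier ones is added.
\<close>

text \<open>Walk two steps inside \<open>A\<close> along \<open>R\<close>, from \<open>a\<close> to
  \<open>b\<close> to \<open>c\<close>. Asymmetry excludes loops and also \<open>c = a\<close>, so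
  the three are distinct.\<close>

lemma card_ge_3_if_no_sink:
  assumes fin: "finite A" and ne: "A \<noteq> {}"
    and asym: "\<And>x y. (x, y) \<in> R \<Longrightarrow> (y, x) \<notin> R"
    and no_sink: "\<And>x. x \<in> A \<Longrightarrow> \<exists>y\<in>A. (x, y) \<in> R"
  shows "3 \<le> card A"
proof -
  obtain a where a: "a \<in> A" using ne by auto
  obtain b where b: "b \<in> A" "(a, b) \<in> R" using no_sink[OF a] by auto
  obtain c where c: "c \<in> A" "(b, c) \<in> R" using no_sink[OF b(1)] by auto
  have "a \<noteq> b" "b \<noteq> c" "a \<noteq> c" using asym b(2) c(2) by blast+
  then have "card {a, b, c} = 3" by simp
  moreover have "card {a, b, c} \<le> card A" using a b c fin by (intro card_mono) auto
  ultimately show ?thesis by simp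
qed

text \<open>\<open>A\<close> and its converse are disjoint, equally large halves of the set of
  ordered pairs of distinct vertices.\<close>

lemma card_tournament:
  assumes fin: "finite V"
    and asym: "\<And>u v. (u, v) \<in> A \<Longrightarrow> (v, u) \<notin> A"
    and total: "A \<union> A\<inverse> = {(u, v). u \<in> V \<and> v \<in> V \<and> u \<noteq> v}"
  shows "2 * card A = card V * (card V - 1)"
proof -
  have sub: "A \<subseteq> V \<times> V" using total by auto
  then have finA: "finite A" using fin by (meson finite_SigmaI finite_subset)
  have disj: "A \<inter> A\<inverse> = {}" using asym by auto
  have "2 * card A = card (A \<union> A\<inverse>)"
    using finA disj by (simp add: card_Un_disjoint)
  also have "A \<union> A\<inverse> = Sigma V (\<lambda>u. V - {u})" unfolding total by auto
  also have "card \<dots> = card V * (card V - 1)" using fin by simp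
  finally show ?thesis .
qed

lemma competitive_tournament_card_ge_7:
  assumes fin: "finite V" and two: "2 \<le> card V"
    and asym: "\<And>u v. (u, v) \<in> A \<Longrightarrow> (v, u) \<notin> A"
    and total: "A \<union> A\<inverse> = {(u, v). u \<in> V \<and> v \<in> V \<and> u \<noteq> v}"
    and common: "\<And>x y. x \<in> V \<Longrightarrow> y \<in> V \<Longrightarrow> x \<noteq> y \<Longrightarrow> \<exists>z. (x, z) \<in> A \<and> (y, z) \<in> A"
  shows "7 \<le> card V"
proof -
  have sub: "A \<subseteq> V \<times> V" using total by auto
  have out_degree: "3 \<le> card (A `` {x})" if x: "x \<in> V" for x
  proof (rule card_ge_3_if_no_sink[OF _ _ asym])
    show "finite (A `` {x})" using sub fin by (auto intro: finite_subset[of _ V])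
    \<comment> \<open>A second vertex \<open>y\<close> exists, and its common out-neighbour with
      \<open>x\<close> shows that \<open>x\<close> has an out-neighbour at all.\<close>
    have "\<not> is_singleton V" using two by (auto simp: is_singleton_altdef)
    then obtain y where "y \<in> V" "x \<noteq> y" using x by (auto simp: is_singleton_def)
    then show "A `` {x} \<noteq> {}" using common[OF x] by blast
  next
    fix y assume "y \<in> A `` {x}"
    then have "(x, y) \<in> A" by simp
    then have "y \<in> V" "x \<noteq> y" using sub asym by blast+
    then show "\<exists>z\<in>A `` {x}. (y, z) \<in> A" using common[OF x] by blast
  qed
  have "3 * card V = (\<Sum>x\<in>V. 3)" by simp
  also have "\<dots> \<le> (\<Sum>x\<in>V. card (A `` {x}))" by (intro sum_mono out_degree)
  also have "\<dots> = card (Sigma V (\<lambda>x. A `` {x}))"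
    using sub fin by (intro card_SigmaI[symmetric]) (auto intro: finite_subset[of _ V])
  also have "Sigma V (\<lambda>x. A `` {x}) = A" using sub by auto
  finally have "3 * card V \<le> card A" .
  then have "6 * card V \<le> card V * (card V - 1)"
    using card_tournament[OF fin asym total] by linarith
  \<comment> \<open>Cancelling the positive factor \<open>card V\<close> leaves
    \<open>6 \<le> card V - 1\<close>.\<close>
  then show ?thesis using two by (simp add: mult.commute)
qed

text \<open>Below 7 this is the Paley tournament: 1, 2, 4 are the nonzero squares modulo 7, and
  adding 7 first keeps the subtraction on naturals from truncating. Each label from 7 on dominates
  all smaller ones.\<close>

definition extended_Paley :: "nat \<Rightarrow> nat \<Rightarrow> bool" where
  "extended_Paley i j \<longleftrightarrow>
     (if i < 7 \<and> j < 7 then (j + 7 - i) mod 7 \<in> {1, 2, 4} else j < i)"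

text \<open>Turns claims about the seven Paley vertices into finite conjunctions that the simplifier
  evaluates.\<close>

lemma ball_less_7: "(\<forall>i<7. P i) \<longleftrightarrow> P 0 \<and> P 1 \<and> P 2 \<and> P 3 \<and> P 4 \<and> P 5 \<and> P (6 :: nat)"
  by (simp add: numeral_eq_Suc All_less_Suc conj_ac)

text \<open>Below 7 this reflects that -1 is not a square modulo 7, though the proof simply checks
  all pairs; elsewhere it is linearity of the order.\<close>

lemma extended_Paley_asym_total:
  assumes "i \<noteq> j"
  shows "extended_Paley i j \<longleftrightarrow> \<not> extended_Paley j i"
proof (cases "i < 7 \<and> j < 7")
  case True
  have "\<forall>i<7. \<forall>j<7. i \<noteq> j \<longrightarrow> (extended_Paley i j \<longleftrightarrow> \<not> extended_Paley j i)"
    unfolding ball_less_7 by (simp add: extended_Paley_def)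
  then show ?thesis using True assms by blast
next
  case False
  then show ?thesis using assms by (auto simp: extended_Paley_def)
qed

lemma extended_Paley_irrefl: "\<not> extended_Paley i i"
  by (simp add: extended_Paley_def)

text \<open>The bound \<open>k < 7\<close> ensures that the witness is the label of a vertex in
  every tournament of order at least 7. A label from 7 on dominates all Paley vertices, so it
  imposes no constraint on \<open>k\<close>.\<close>

lemma extended_Paley_common_out_neighbour:
  assumes "i \<noteq> j"
  shows "\<exists>k<7. extended_Paley i k \<and> extended_Paley j k"
proof -
  \<comment> \<open>The existential is written as a negated universal so that
    \<open>ball_less_7\<close> expands it too.\<close>
  have "\<forall>p<7. \<forall>q<7. p \<noteq> q \<longrightarrow> \<not> (\<forall>k<7. \<not> (extended_Paley p k \<and> extended_Paley q k))"
    unfolding ball_less_7 by (simp add: extended_Paley_def)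
  then have Paley: "\<exists>k<7. extended_Paley p k \<and> extended_Paley q k"
    if "p < 7" "q < 7" "p \<noteq> q" for p q
    using that by blast
  have outer: "extended_Paley p k" if "7 \<le> p" "k < 7" for p k
    using that by (simp add: extended_Paley_def)
  have out: "\<exists>k<7. extended_Paley p k" if "p < 7" for p
    \<comment> \<open>Pair \<open>p\<close> with a different Paley vertex: 1 if
      \<open>p = 0\<close>, and 0 otherwise.\<close>
    using Paley[OF that, of 0] Paley[OF that, of 1] by (cases "p = 0") auto
  consider "i < 7" "j < 7" | "7 \<le> i" "7 \<le> j" | "7 \<le> i" "j < 7" | "i < 7" "7 \<le> j"
    by linarith
  then show ?thesis
  proof cases
    case 1 then show ?thesis using Paley assms by blast
  next
    case 2 then show ?thesis using outer by (intro exI[of _ 0]) simp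
  next
    case 3 then show ?thesis using outer out by blast
  next
    case 4 then show ?thesis using outer out by blast
  qed
qed

lemma competitive_tournament_exists:
  assumes fin: "finite V" and seven: "7 \<le> card V"
  obtains A where "\<And>u v. (u, v) \<in> A \<Longrightarrow> (v, u) \<notin> A"
    and "A \<union> A\<inverse> = {(u, v). u \<in> V \<and> v \<in> V \<and> u \<noteq> v}"
    and "\<And>x y. x \<in> V \<Longrightarrow> y \<in> V \<Longrightarrow> x \<noteq> y \<Longrightarrow> \<exists>z. (x, z) \<in> A \<and> (y, z) \<in> A"
proof -
  obtain f where f: "bij_betw f V {0..<card V}"
    using ex_bij_betw_finite_nat[OF fin] by blast
  have inj: "f u \<noteq> f v" if "u \<in> V" "v \<in> V" "u \<noteq> v" for u v
    using f that by (auto simp: bij_betw_def dest: inj_onD)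
  define A where "A = {(u, v). u \<in> V \<and> v \<in> V \<and> extended_Paley (f u) (f v)}"
  show ?thesis
  proof (rule that)
    show "(v, u) \<notin> A" if "(u, v) \<in> A" for u v
      using that extended_Paley_asym_total[of "f u" "f v"] extended_Paley_irrefl[of "f u"]
      by (cases "f u = f v") (auto simp: A_def)
    show "A \<union> A\<inverse> = {(u, v). u \<in> V \<and> v \<in> V \<and> u \<noteq> v}"
    proof -
      have "(u, v) \<in> A \<or> (v, u) \<in> A \<longleftrightarrow> u \<in> V \<and> v \<in> V \<and> u \<noteq> v" for u v
        using inj[of u v] extended_Paley_asym_total[of "f u" "f v"] extended_Paley_irrefl[of "f u"]
        by (auto simp: A_def)
      then show ?thesis by auto
    qed
    show "\<exists>z. (x, z) \<in> A \<and> (y, z) \<in> A" if xy: "x \<in> V" "y \<in> V" "x \<noteq> y" for x y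
    proof -
      obtain k where k: "k < 7" "extended_Paley (f x) k" "extended_Paley (f y) k"
        using extended_Paley_common_out_neighbour[OF inj[OF xy]] by blast
      \<comment> \<open>The labels fill \<open>{0..<card V}\<close>, which contains \<open>k\<close>
        because \<open>card V\<close> is at least 7.\<close>
      have "k \<in> f ` V" using f k(1) seven by (auto simp: bij_betw_def)
      then show ?thesis using k xy unfolding A_def by auto
    qed
  qed
qed

text \<open>Brings the underlying-graph condition of \<open>orientation_of\<close> into the form
  used by the tournament lemmas.\<close>

lemma parcs_mk_symmetric_with_proj: "parcs (mk_symmetric (with_proj D)) = parcs D \<union> (parcs D)\<inverse>"
  by (auto simp: parcs_mk_symmetric intro: bexI[rotated])

theorem mainTheorem5:
  fixes n :: nat and G :: "('a, 'b) pre_digraph"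
  assumes "n \<ge> 2" and "complete_digraph n G"
  shows "competitively_orientable G \<longleftrightarrow> n \<ge> 7"
proof -
  interpret graph G using assms(2) by (simp add: complete_digraph_def)
  have card: "card (verts G) = n"
    and ends: "arcs_ends G = {(u, v). u \<in> verts G \<and> v \<in> verts G \<and> u \<noteq> v}"
    using assms(2) by (auto simp: complete_digraph_def)
  show ?thesis
  proof
    assume "competitively_orientable G"
    then obtain D where D: "orientation_of D G" "competitive (with_proj D)"
      by (auto simp: competitively_orientable_def)
    have "7 \<le> card (verts G)"
    proof (rule competitive_tournament_card_ge_7)
      show "(v, u) \<notin> parcs D" if "(u, v) \<in> parcs D" for u v
        using that D(1) by (auto simp: orientation_of_def)
      show "parcs D \<union> (parcs D)\<inverse> = {(u, v). u \<in> verts G \<and> v \<in> verts G \<and> u \<noteq> v}"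
        using D(1) ends by (simp add: orientation_of_def parcs_mk_symmetric_with_proj)
      show "\<exists>z. (x, z) \<in> parcs D \<and> (y, z) \<in> parcs D"
        if "x \<in> verts G" "y \<in> verts G" "x \<noteq> y" for x y
        using that D by (simp add: orientation_of_def competitive_def) blast
    qed (use assms(1) card in auto)
    then show "7 \<le> n" using card by simp
  next
    assume "7 \<le> n"
    then obtain A where asym: "\<And>u v. (u, v) \<in> A \<Longrightarrow> (v, u) \<notin> A"
      and total: "A \<union> A\<inverse> = {(u, v). u \<in> verts G \<and> v \<in> verts G \<and> u \<noteq> v}"
      and common: "\<And>x y. x \<in> verts G \<Longrightarrow> y \<in> verts G \<Longrightarrow> x \<noteq> y \<Longrightarrow> \<exists>z. (x, z) \<in> A \<and> (y, z) \<in> A"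
      using competitive_tournament_exists[OF finite_verts] unfolding card by blast
    have sub: "A \<subseteq> verts G \<times> verts G" using total by auto
    then have "finite A" by (meson finite_SigmaI finite_subset finite_verts)
    define D where "D = \<lparr>pverts = verts G, parcs = A\<rparr>"
    \<comment> \<open>A loop would be its own reverse, so asymmetry yields the loop-freeness that
      \<open>pair_digraph\<close> demands.\<close>
    have "fst e \<noteq> snd e" if "e \<in> A" for e
      using that asym by (cases e) auto
    then have "pair_digraph D"
      using sub \<open>finite A\<close> by unfold_locales (auto simp: D_def)
    then have "orientation_of D G"
      using asym total ends by (auto simp: orientation_of_def parcs_mk_symmetric_with_proj D_def)
    moreover have "competitive (with_proj D)"
      \<comment> \<open>\<open>competitive\<close> also wants the common out-neighbour to be a
        vertex, which \<open>sub\<close> provides.\<close>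
      using common sub by (simp add: competitive_def D_def) blast
    ultimately show "competitively_orientable G"
      unfolding competitively_orientable_def by blast
  qed
qed

end
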